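(* Let $\mathscr{H}$ be a complex Hilbert space and let $A\in\mathbb{B}(\mathscr{H})$. Then \begin{align*} \frac{1}{4}\|A^*A+AA^*\| &\leq\frac{1}{4}\left\{\frac{3}{2}\|\Re(A)+\Im(A)\|^4+\frac{3}{2}\|\Re(A)-\Im(A)\|^4+\|\Re(A)+\Im(A)\|^2\,\|\Re(A)-\Im(A)\|^2\right\}^{\frac{1}{2}}\\ &\leq w^2(A). \end{align*}
   Context: $\mathbb{B}(\mathscr{H})$ is the algebra of all bounded linear operators on the complex Hilbert space $\mathscr{H}$, and $\|\cdot\|$ is the operator norm. $\Re(A)=\frac{1}{2}(A+A^* )$ and $\Im(A)=\frac{1}{2\mathrm{i}}(A-A^* )$ (both are self-adjoint operators). The numerical radius is $w(A)=\sup\{|\langle Ax,x\rangle|: x\in\mathscr{H},\ \|x\|=1\}$, and $w^2(A)$ means $(w(A))^2$. *)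

theory Defs
  imports "HOL-Analysis.Analysis"
begin

class scaleC =
  fixes scaleC :: "complex \<Rightarrow> 'a \<Rightarrow> 'a" (infixr \<open>*\<^sub>C\<close> 75)

(* The real structure of the library classes is required to be the restriction of
   the complex one, so that real_normed_vector and onorm can be reused. *)
class complex_vector = real_vector + scaleC +
  assumes scaleR_scaleC: "scaleR r x = complex_of_real r *\<^sub>C x"
    and scaleC_add_right: "c *\<^sub>C (x + y) = c *\<^sub>C x + c *\<^sub>C y"
    and scaleC_add_left: "(c + d) *\<^sub>C x = c *\<^sub>C x + d *\<^sub>C x"
    and scaleC_scaleC: "c *\<^sub>C d *\<^sub>C x = (c * d) *\<^sub>C x"
    and scaleC_one: "1 *\<^sub>C x = x"

(* The inner product is linear in the first and conjugate-linear in the second argument. *)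
class complex_inner = complex_vector + real_normed_vector +
  fixes cinner :: "'a \<Rightarrow> 'a \<Rightarrow> complex"
  assumes cinner_commute: "cinner x y = cnj (cinner y x)"
    and cinner_add_left: "cinner (x + y) z = cinner x z + cinner y z"
    and cinner_scaleC_left: "cinner (c *\<^sub>C x) y = c * cinner x y"
    and cinner_ge_zero: "0 \<le> Re (cinner x x)"
    and cinner_eq_zero_iff: "cinner x x = 0 \<longleftrightarrow> x = 0"
    and norm_eq_sqrt_cinner: "norm x = sqrt (Re (cinner x x))"

class chilbert_space = complex_inner + complete_space

instantiation complex :: chilbert_space
begin

definition "scaleC_complex (c::complex) (x::complex) = c * x"
definition "cinner_complex (x::complex) (y::complex) = x * cnj y"

instance
proof
  fix x :: complex
  show "norm x = sqrt (Re (cinner x x))"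
    by (simp add: cinner_complex_def cmod_def power2_eq_square)
qed (auto simp: scaleC_complex_def cinner_complex_def scaleR_conv_of_real algebra_simps)

end

definition bounded_clinear :: "('a::complex_inner \<Rightarrow> 'b::complex_inner) \<Rightarrow> bool" where
  "bounded_clinear A \<longleftrightarrow> bounded_linear A \<and> (\<forall>c x. A (c *\<^sub>C x) = c *\<^sub>C A x)"

(* For a bounded operator on a Hilbert space the adjoint exists and is unique,
   so the description is then proper. *)
definition cadjoint :: "('a::chilbert_space \<Rightarrow> 'a) \<Rightarrow> 'a \<Rightarrow> 'a" where
  "cadjoint A = (THE B. \<forall>x y. cinner (A x) y = cinner x (B y))"

definition op_Re :: "('a::chilbert_space \<Rightarrow> 'a) \<Rightarrow> 'a \<Rightarrow> 'a" where
  "op_Re A = (\<lambda>x. (1 / 2) *\<^sub>C (A x + cadjoint A x))"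

definition op_Im :: "('a::chilbert_space \<Rightarrow> 'a) \<Rightarrow> 'a \<Rightarrow> 'a" where
  "op_Im A = (\<lambda>x. (1 / (2 * \<i>)) *\<^sub>C (A x - cadjoint A x))"

(* On the zero space the supremum is over the empty set, where the real-valued Sup
   is unspecified. *)
definition numerical_radius :: "('a::chilbert_space \<Rightarrow> 'a) \<Rightarrow> real" where
  "numerical_radius A = (SUP x\<in>{x. norm x = 1}. cmod (cinner (A x) x))"

end

theory Submission
  imports Defs
begin

text \<open>
  Write \<open>R\<close> and \<open>J\<close> for the real and imaginary parts of \<open>A\<close>, and put \<open>S = R + J\<close>, \<open>D = R - J\<close>,
  \<open>s = \<parallel>S\<parallel>\<close>, \<open>d = \<parallel>D\<parallel>\<close>. Both inequalities follow from looking at the self-adjoint operators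
  \<open>S\<close> and \<open>D\<close> instead of \<open>A\<close>.

  For the first one, \<open>A\<^sup>*A + AA\<^sup>* = 2(R\<^sup>2 + J\<^sup>2) = S\<^sup>2 + D\<^sup>2\<close> (lemma \<open>cadjoint_sum_eq_squares\<close>), so
  its norm is at most \<open>s\<^sup>2 + d\<^sup>2\<close>. The square of this bound differs from the expression under the
  square root by \<open>(s\<^sup>2 - d\<^sup>2)\<^sup>2 / 2\<close>.

  For the second one, \<open>\<langle>Sx,x\<rangle>\<close> and \<open>\<langle>Dx,x\<rangle>\<close> are the sum and the difference of the real and the
  imaginary part of \<open>\<langle>Ax,x\<rangle>\<close>, hence bounded by \<open>\<surd>2 w(A)\<close> on unit vectors. The norm of a
  self-adjoint operator is controlled by its quadratic form (lemma
  \<open>norm_le_of_symmetric_form_le\<close>), so \<open>s\<^sup>2\<close> and \<open>d\<^sup>2\<close> are at most \<open>2 w(A)\<^sup>2\<close>, and the expression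
  under the square root is at most \<open>(6 + 6 + 4) w(A)\<^sup>4\<close>.

  All of this needs the adjoint to exist, which is the Riesz representation theorem. It is obtained
  here in its real form (lemma \<open>riesz_representation_Re\<close>) by minimising the functional
  \<open>\<parallel>x\<parallel>\<^sup>2/2 - g(x)\<close>, and carried over to complex-linear maps by testing with \<open>x\<close> and \<open>\<i>x\<close>.
\<close>

section \<open>Complex inner product spaces\<close>

lemma scaleC_zero_right [simp]: "c *\<^sub>C (0::'a::complex_vector) = 0"
  using scaleC_add_right[of c "0::'a" 0] by simp

lemma scaleC_zero_left [simp]: "0 *\<^sub>C (x::'a::complex_vector) = 0"
  using scaleC_add_left[of 0 0 x] by simp

lemma scaleC_minus_right: "c *\<^sub>C (- x) = - (c *\<^sub>C (x::'a::complex_vector))"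
  using scaleC_add_right[of c x "- x"] by (simp add: eq_neg_iff_add_eq_0 add.commute)

lemma scaleC_diff_right: "c *\<^sub>C (x - y) = c *\<^sub>C x - c *\<^sub>C (y::'a::complex_vector)"
  using scaleC_add_right[of c x "- y"] by (simp add: scaleC_minus_right)

lemma scaleC_minus_left: "(- c) *\<^sub>C x = - (c *\<^sub>C (x::'a::complex_vector))"
  using scaleC_add_left[of c "- c" x] by (simp add: eq_neg_iff_add_eq_0 add.commute)

lemma cinner_minus_left: "cinner (- x) y = - cinner (x::'a::complex_inner) y"
  using cinner_scaleC_left[of "-1" x y] by (simp add: scaleC_minus_left scaleC_one)

lemma cinner_diff_left: "cinner (x - y) z = cinner x z - cinner (y::'a::complex_inner) z"
  using cinner_add_left[of x "- y" z] by (simp add: cinner_minus_left)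

lemma cinner_add_right: "cinner x (y + z) = cinner x y + cinner (x::'a::complex_inner) z"
  by (metis cinner_add_left cinner_commute complex_cnj_add)

lemma cinner_diff_right: "cinner x (y - z) = cinner x y - cinner (x::'a::complex_inner) z"
  by (metis cinner_diff_left cinner_commute complex_cnj_diff)

lemma cinner_scaleC_right: "cinner x (c *\<^sub>C y) = cnj c * cinner (x::'a::complex_inner) y"
  by (metis cinner_scaleC_left cinner_commute complex_cnj_mult)

lemma cinner_scaleR_left: "cinner (r *\<^sub>R x) y = of_real r * cinner (x::'a::complex_inner) y"
  by (simp add: scaleR_scaleC cinner_scaleC_left)

lemma cinner_scaleR_right: "cinner x (r *\<^sub>R y) = of_real r * cinner (x::'a::complex_inner) y"
  by (simp add: scaleR_scaleC cinner_scaleC_right)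

lemmas cinner_linear = cinner_add_left cinner_add_right cinner_diff_left cinner_diff_right
  cinner_scaleC_left cinner_scaleC_right cinner_scaleR_left cinner_scaleR_right

lemma Re_cinner_commute: "Re (cinner x y) = Re (cinner y (x::'a::complex_inner))"
  by (metis cinner_commute cnj.sel(1))

lemma power2_norm_eq_Re_cinner: "(norm x)\<^sup>2 = Re (cinner x (x::'a::complex_inner))"
  by (simp add: norm_eq_sqrt_cinner cinner_ge_zero)

lemma power2_norm_add:
  "(norm (x + y))\<^sup>2 = (norm x)\<^sup>2 + 2 * Re (cinner x y) + (norm (y::'a::complex_inner))\<^sup>2"
  by (simp add: power2_norm_eq_Re_cinner cinner_linear Re_cinner_commute[of y x])

lemma power2_norm_diff:
  "(norm (x - y))\<^sup>2 = (norm x)\<^sup>2 - 2 * Re (cinner x y) + (norm (y::'a::complex_inner))\<^sup>2"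
  by (simp add: power2_norm_eq_Re_cinner cinner_linear Re_cinner_commute[of y x])

lemma parallelogram_law:
  "(norm (x + y))\<^sup>2 + (norm (x - y))\<^sup>2 = 2 * (norm x)\<^sup>2 + 2 * (norm (y::'a::complex_inner))\<^sup>2"
  by (simp add: power2_norm_add power2_norm_diff)

lemma norm_scaleC: "norm (c *\<^sub>C x) = cmod c * norm (x::'a::complex_inner)"
proof -
  have "cinner (c *\<^sub>C x) (c *\<^sub>C x) = of_real ((cmod c)\<^sup>2) * cinner x x"
    by (simp add: cinner_linear complex_norm_square ac_simps del: of_real_power)
  then have "(norm (c *\<^sub>C x))\<^sup>2 = (cmod c * norm x)\<^sup>2"
    by (simp add: power2_norm_eq_Re_cinner power_mult_distrib del: of_real_power)
  then show ?thesis
    by simp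
qed

lemma bounded_linear_scaleC: "bounded_linear (\<lambda>x::'a::complex_inner. c *\<^sub>C x)"
  by (rule bounded_linear_intro[of _ "cmod c"])
    (simp_all add: scaleC_add_right scaleR_scaleC scaleC_scaleC norm_scaleC ac_simps)

lemma Re_cinner_le_norm: "Re (cinner x y) \<le> norm x * norm (y::'a::complex_inner)"
proof (cases "x = 0 \<or> y = 0")
  case True
  then show ?thesis
    using cinner_scaleR_left[of 0 x y] cinner_scaleR_right[of x 0 y] by auto
next
  case False
  \<comment> \<open>The vectors \<open>\<parallel>y\<parallel>x\<close> and \<open>\<parallel>x\<parallel>y\<close> have equal length; expand the square of their distance.\<close>
  have "0 \<le> (norm (norm y *\<^sub>R x - norm x *\<^sub>R y))\<^sup>2"
    by simp
  also have "\<dots> = 2 * (norm x * norm y) * (norm x * norm y - Re (cinner x y))"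
    unfolding power2_norm_diff by (simp add: cinner_linear power2_eq_square algebra_simps)
  finally show ?thesis
    using False by (simp add: zero_le_mult_iff mult_le_0_iff)
qed

lemma cmod_cinner_le_norm: "cmod (cinner x y) \<le> norm x * norm (y::'a::complex_inner)"
proof -
  \<comment> \<open>Rotating \<open>x\<close> by a phase makes the inner product real and nonnegative.\<close>
  define u where "u = cnj (sgn (cinner x y))"
  have "u * cinner x y = of_real (cmod (cinner x y))"
    using complex_norm_square[of "cinner x y"]
    by (cases "cinner x y = 0")
      (simp_all add: u_def sgn_div_norm scaleR_conv_of_real power2_eq_square field_simps)
  then have "cmod (cinner x y) = Re (cinner (u *\<^sub>C x) y)"
    by (simp add: cinner_scaleC_left)
  also have "\<dots> \<le> cmod u * norm x * norm y"
    by (metis Re_cinner_le_norm norm_scaleC)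
  also have "\<dots> \<le> 1 * (norm x * norm y)"
    unfolding mult.assoc by (rule mult_right_mono) (auto simp: u_def norm_sgn)
  finally show ?thesis
    by simp
qed

lemma eq_of_cinner_eq:
  assumes "\<And>x. cinner x y = cinner x (z::'a::complex_inner)"
  shows "y = z"
proof -
  have "cinner (y - z) (y - z) = 0"
    using assms by (simp add: cinner_diff_right)
  then show ?thesis
    by (simp add: cinner_eq_zero_iff)
qed

section \<open>Riesz representation and the adjoint\<close>

lemma linear_coefficient_eq_zero:
  fixes a b :: real
  assumes "\<And>t. 0 \<le> t * a + t\<^sup>2 * b"
  shows "a = 0"
proof (rule ccontr)
  assume "a \<noteq> 0"
  \<comment> \<open>A step against the sign of \<open>a\<close>, short enough that the linear term dominates the quadratic one.\<close>
  define c where "c = \<bar>b\<bar> + 1"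
  have "c > 0" "b < c"
    by (auto simp: c_def)
  have "(- a / c) * a + (- a / c)\<^sup>2 * b = (a\<^sup>2 / c\<^sup>2) * (b - c)"
    using \<open>c > 0\<close> by (simp add: field_simps power2_eq_square)
  moreover have "(a\<^sup>2 / c\<^sup>2) * (b - c) < 0"
    using \<open>a \<noteq> 0\<close> \<open>c > 0\<close> \<open>b < c\<close> by (intro mult_pos_neg) auto
  ultimately show False
    using assms[of "- a / c"] by simp
qed

text \<open>
  The representing vector is the minimiser of \<open>F x = \<parallel>x\<parallel>\<^sup>2/2 - g x\<close>. By the parallelogram law two
  points at which \<open>F\<close> is close to its infimum are close to each other, so completeness provides the
  minimiser; there the derivative of \<open>F\<close> vanishes in every direction.
\<close>

lemma riesz_representation_Re:
  fixes g :: "'a::chilbert_space \<Rightarrow> real"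
  assumes "bounded_linear g"
  obtains y where "\<And>x. g x = Re (cinner x y)"
proof -
  interpret g: bounded_linear g by fact
  define F where "F x = (norm x)\<^sup>2 / 2 - g x" for x
  define m where "m = Inf (range F)"
  obtain K where K: "\<And>x. \<bar>g x\<bar> \<le> norm x * K"
    using g.bounded by auto
  have "- (K\<^sup>2) / 2 \<le> F x" for x
  proof -
    have "0 \<le> (norm x - K)\<^sup>2" by simp
    then show ?thesis
      using K[of x] by (simp add: F_def power2_eq_square algebra_simps)
  qed
  then have bdd: "bdd_below (range F)"
    by (intro bdd_belowI2)
  have m_le: "m \<le> F x" for x
    unfolding m_def by (rule cInf_lower[OF _ bdd]) auto
  have close: "(norm (x - y))\<^sup>2 \<le> 4 * (F x - m) + 4 * (F y - m)" for x y
  proof -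
    have "F ((1/2) *\<^sub>R (x + y)) = (norm (x + y))\<^sup>2 / 8 - (g x + g y) / 2"
      unfolding F_def g.scaleR g.add norm_scaleR by (simp add: power_divide)
    then have "F x + F y - 2 * F ((1/2) *\<^sub>R (x + y)) = (norm (x - y))\<^sup>2 / 4"
      using parallelogram_law[of x y] by (simp add: F_def field_simps del: scaleR_add_right)
    then show ?thesis
      using m_le[of "(1/2) *\<^sub>R (x + y)"] by simp
  qed
  have "\<exists>x. F x < m + inverse (real (Suc n))" for n
    using cInf_lessD[of "range F" "m + inverse (real (Suc n))"] by (auto simp: m_def)
  then obtain X where X: "\<And>n. F (X n) < m + inverse (real (Suc n))"
    by metis
  have "Cauchy X"
  proof (rule metric_CauchyI)
    fix e :: real
    assume "e > 0"
    \<comment> \<open>The lemma \<open>close\<close> needs both values of \<open>F\<close> to be within \<open>e\<^sup>2/8\<close> of the infimum.\<close>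
    then obtain N where N: "inverse (real (Suc N)) < e\<^sup>2 / 8"
      using reals_Archimedean[of "e\<^sup>2 / 8"] by auto
    have near: "F (X n) - m < e\<^sup>2 / 8" if "n \<ge> N" for n
    proof -
      have "inverse (real (Suc n)) \<le> inverse (real (Suc N))"
        using that by (intro le_imp_inverse_le) auto
      then show ?thesis
        using X[of n] N by linarith
    qed
    have "dist (X k) (X n) < e" if "k \<ge> N" "n \<ge> N" for k n
    proof (rule power2_less_imp_less)
      show "(dist (X k) (X n))\<^sup>2 < e\<^sup>2"
        using close[of "X k" "X n"] near[OF that(1)] near[OF that(2)] by (simp add: dist_norm)
    qed (use \<open>e > 0\<close> in simp)
    then show "\<exists>N. \<forall>k\<ge>N. \<forall>n\<ge>N. dist (X k) (X n) < e"
      by blast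
  qed
  then obtain y where y: "X \<longlonglongrightarrow> y"
    using Cauchy_convergent convergent_def by blast
  have "(\<lambda>n. F (X n)) \<longlonglongrightarrow> F y"
    unfolding F_def by (intro tendsto_intros g.tendsto y) auto
  moreover have "(\<lambda>n. m + inverse (real (Suc n))) \<longlonglongrightarrow> m"
    using tendsto_add[OF tendsto_const LIMSEQ_inverse_real_of_nat] by simp
  ultimately have "F y \<le> m"
    using X by (intro LIMSEQ_le) (auto intro: less_imp_le)
  then have minimal: "F y \<le> F x" for x
    using m_le[of x] by simp
  have "g h = Re (cinner h y)" for h
  proof -
    have "0 \<le> t * (Re (cinner h y) - g h) + t\<^sup>2 * ((norm h)\<^sup>2 / 2)" for t
    proof -
      have "F (y + t *\<^sub>R h) = F y + (t * (Re (cinner h y) - g h) + t\<^sup>2 * ((norm h)\<^sup>2 / 2))"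
        by (simp add: F_def power2_norm_add g.add g.scaleR cinner_linear Re_cinner_commute[of y h]
            power_mult_distrib algebra_simps add_divide_distrib)
      then show ?thesis
        using minimal[of "y + t *\<^sub>R h"] by simp
    qed
    from linear_coefficient_eq_zero[OF this] show ?thesis
      by simp
  qed
  then show ?thesis
    by (rule that)
qed

lemma cadjoint_exists:
  fixes A :: "'a::chilbert_space \<Rightarrow> 'a"
  assumes "bounded_clinear A"
  shows "\<exists>B. \<forall>x y. cinner (A x) y = cinner x (B y)"
proof -
  interpret A: bounded_linear A
    using assms by (simp add: bounded_clinear_def)
  have clin: "A (c *\<^sub>C x) = c *\<^sub>C A x" for c x
    using assms by (simp add: bounded_clinear_def)
  have "\<exists>z. \<forall>x. cinner (A x) y = cinner x z" for y
  proof -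
    obtain K where K: "\<And>x. norm (A x) \<le> norm x * K"
      using A.bounded by auto
    have "bounded_linear (\<lambda>x. Re (cinner (A x) y))"
    proof (rule bounded_linear_intro[of _ "K * norm y"])
      fix x
      have "\<bar>Re (cinner (A x) y)\<bar> \<le> norm (A x) * norm y"
        using abs_Re_le_cmod cmod_cinner_le_norm order_trans by blast
      also have "\<dots> \<le> norm x * K * norm y"
        by (intro mult_right_mono K) auto
      finally show "norm (Re (cinner (A x) y)) \<le> norm x * (K * norm y)"
        by (simp add: mult.assoc)
    qed (simp_all add: A.add A.scaleR cinner_linear)
    then obtain z where z: "\<And>x. Re (cinner (A x) y) = Re (cinner x z)"
      by (rule riesz_representation_Re) blast
    have "cinner (A x) y = cinner x z" for x
    proof (rule complex_eqI)
      \<comment> \<open>Replacing \<open>x\<close> by \<open>\<i>x\<close> turns real parts into negated imaginary parts.\<close>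
      show "Im (cinner (A x) y) = Im (cinner x z)"
        using z[of "\<i> *\<^sub>C x"] by (simp add: clin cinner_linear)
    qed (rule z)
    then show ?thesis
      by blast
  qed
  then show ?thesis
    by metis
qed

lemma cinner_cadjoint:
  fixes A :: "'a::chilbert_space \<Rightarrow> 'a"
  assumes "bounded_clinear A"
  shows "cinner (A x) y = cinner x (cadjoint A y)"
proof -
  obtain B where B: "\<forall>x y. cinner (A x) y = cinner x (B y)"
    using cadjoint_exists[OF assms] by blast
  have "C = B" if "\<forall>x y. cinner (A x) y = cinner x (C y)" for C
  proof
    show "C y = B y" for y
      by (rule eq_of_cinner_eq) (metis that B)
  qed
  with B have "\<forall>x y. cinner (A x) y = cinner x (cadjoint A y)"
    unfolding cadjoint_def by (rule theI[where P = "\<lambda>B. \<forall>x y. cinner (A x) y = cinner x (B y)"])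
  then show ?thesis
    by blast
qed

lemma cinner_cadjoint_left:
  fixes A :: "'a::chilbert_space \<Rightarrow> 'a"
  assumes "bounded_clinear A"
  shows "cinner (cadjoint A x) y = cinner x (A y)"
  by (metis assms cinner_cadjoint cinner_commute)

lemma bounded_clinear_cadjoint:
  fixes A :: "'a::chilbert_space \<Rightarrow> 'a"
  assumes "bounded_clinear A"
  shows "bounded_clinear (cadjoint A)"
proof -
  interpret A: bounded_linear A
    using assms by (simp add: bounded_clinear_def)
  note adj = cinner_cadjoint[OF assms, symmetric]
  obtain K where K: "\<And>x. norm (A x) \<le> norm x * K"
    using A.bounded by auto
  have clin: "cadjoint A (c *\<^sub>C x) = c *\<^sub>C cadjoint A x" for c x
    by (rule eq_of_cinner_eq) (simp add: adj cinner_linear)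
  have "bounded_linear (cadjoint A)"
  proof (rule bounded_linear_intro[of _ K])
    fix x y :: 'a and r :: real
    show "cadjoint A (x + y) = cadjoint A x + cadjoint A y"
      by (rule eq_of_cinner_eq) (simp add: adj cinner_linear)
    show "cadjoint A (r *\<^sub>R x) = r *\<^sub>R cadjoint A x"
      by (simp add: scaleR_scaleC clin)
    let ?n = "norm (cadjoint A x)"
    have "?n * ?n = Re (cinner (A (cadjoint A x)) x)"
      by (simp add: adj power2_norm_eq_Re_cinner flip: power2_eq_square)
    also have "\<dots> \<le> norm (A (cadjoint A x)) * norm x"
      by (rule Re_cinner_le_norm)
    also have "\<dots> \<le> ?n * K * norm x"
      by (intro mult_right_mono K) auto
    finally have "?n * ?n \<le> ?n * (norm x * K)"
      by (simp add: ac_simps)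
    moreover have "0 \<le> norm x * K"
      using K[of x] norm_ge_zero order_trans by blast
    ultimately show "?n \<le> norm x * K"
      by (cases "?n = 0") auto
  qed
  with clin show ?thesis
    by (simp add: bounded_clinear_def)
qed

section \<open>Real and imaginary parts of an operator\<close>

context
  fixes A :: "'a::chilbert_space \<Rightarrow> 'a"
  assumes A: "bounded_clinear A"
begin

interpretation A: bounded_linear A
  using A by (simp add: bounded_clinear_def)

interpretation B: bounded_linear "cadjoint A"
  using bounded_clinear_cadjoint[OF A] by (simp add: bounded_clinear_def)

lemma bounded_linear_op_Re: "bounded_linear (op_Re A)"
  unfolding op_Re_def
  by (rule bounded_linear_compose[OF bounded_linear_scaleC
        bounded_linear_add[OF A.bounded_linear_axioms B.bounded_linear_axioms]])

lemma bounded_linear_op_Im: "bounded_linear (op_Im A)"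
  unfolding op_Im_def
  by (rule bounded_linear_compose[OF bounded_linear_scaleC
        bounded_linear_sub[OF A.bounded_linear_axioms B.bounded_linear_axioms]])

lemma cinner_op_Re: "cinner (op_Re A x) y = cinner x (op_Re A y)"
  unfolding op_Re_def cinner_linear cinner_cadjoint[OF A] cinner_cadjoint_left[OF A]
  by (simp add: algebra_simps)

lemma cinner_op_Im: "cinner (op_Im A x) y = cinner x (op_Im A y)"
  unfolding op_Im_def cinner_linear cinner_cadjoint[OF A] cinner_cadjoint_left[OF A]
  by (simp add: algebra_simps)

lemma Re_cinner_op_Re: "Re (cinner (op_Re A x) x) = Re (cinner (A x) x)"
  unfolding op_Re_def cinner_linear cinner_cadjoint_left[OF A]
  using Re_cinner_commute[of "A x" x] by simp

lemma Re_cinner_op_Im: "Re (cinner (op_Im A x) x) = Im (cinner (A x) x)"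
proof -
  have "Im (cinner x (A x)) = - Im (cinner (A x) x)"
    by (subst cinner_commute) simp
  then show ?thesis
    unfolding op_Im_def cinner_linear cinner_cadjoint_left[OF A]
    by (simp add: Re_divide Im_divide)
qed

text \<open>
  In terms of \<open>R = \<Re>(A)\<close> and \<open>J = \<Im>(A)\<close>, \<open>A + A\<^sup>* = 2R\<close> and \<open>A\<^sup>* - A = -2\<i>J\<close>, while
  \<open>A = R + \<i>J\<close> and \<open>A\<^sup>* = R - \<i>J\<close>. Hence \<open>A\<^sup>*A + AA\<^sup>* = (A\<^sup>* + A)R + \<i>(A\<^sup>* - A)J = 2R\<^sup>2 + 2J\<^sup>2\<close>.
\<close>

lemma cadjoint_sum_eq_squares:
  defines "S \<equiv> \<lambda>x. op_Re A x + op_Im A x"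
    and "D \<equiv> \<lambda>x. op_Re A x - op_Im A x"
  shows "cadjoint A (A x) + A (cadjoint A x) = S (S x) + D (D x)"
proof -
  let ?R = "op_Re A" and ?J = "op_Im A" and ?B = "cadjoint A"
  have clin: "A (c *\<^sub>C x) = c *\<^sub>C A x" "?B (c *\<^sub>C x) = c *\<^sub>C ?B x" for c x
    using A bounded_clinear_cadjoint[OF A] by (auto simp: bounded_clinear_def)
  interpret R: bounded_linear ?R by (rule bounded_linear_op_Re)
  interpret J: bounded_linear ?J by (rule bounded_linear_op_Im)
  have AB_add: "A z + ?B z = 2 *\<^sub>R ?R z" for z
    by (simp add: op_Re_def scaleR_scaleC scaleC_scaleC scaleC_one)
  have AB_diff: "\<i> *\<^sub>C ?B z - \<i> *\<^sub>C A z = 2 *\<^sub>R ?J z" for z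
  proof -
    have "2 *\<^sub>R ?J z = (- \<i>) *\<^sub>C (A z - ?B z)"
      by (simp add: op_Im_def scaleR_scaleC scaleC_scaleC)
    then show ?thesis
      by (simp add: scaleC_minus_left scaleC_diff_right)
  qed
  have "\<i> *\<^sub>C ?J x = (1/2) *\<^sub>R (A x - ?B x)" "?R x = (1/2) *\<^sub>R (A x + ?B x)"
    by (simp_all add: op_Re_def op_Im_def scaleR_scaleC scaleC_scaleC)
  then have parts: "A x = ?R x + \<i> *\<^sub>C ?J x" "?B x = ?R x - \<i> *\<^sub>C ?J x"
    by (simp_all flip: scaleR_add_right scaleR_diff_right scaleR_2
        del: scaleR_add_right scaleR_diff_right)
  have "?B (A x) + A (?B x)
      = (A (?R x) + ?B (?R x)) + (\<i> *\<^sub>C ?B (?J x) - \<i> *\<^sub>C A (?J x))"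
    by (subst parts(1), subst parts(2)) (simp add: A.diff B.add clin)
  also have "\<dots> = 2 *\<^sub>R ?R (?R x) + 2 *\<^sub>R ?J (?J x)"
    by (simp only: AB_add AB_diff)
  also have "\<dots> = S (S x) + D (D x)"
    by (simp add: S_def D_def R.add R.diff J.add J.diff scaleR_2)
  finally show ?thesis .
qed

end

section \<open>Operator norm and numerical radius\<close>

text \<open>
  For real parts of inner products, polarisation gives
  \<open>4\<langle>Tx,y\<rangle> = \<langle>T(x+y),x+y\<rangle> - \<langle>T(x-y),x-y\<rangle>\<close>, which the parallelogram law bounds by
  \<open>2M(\<parallel>x\<parallel>\<^sup>2 + \<parallel>y\<parallel>\<^sup>2)\<close>; the choice of \<open>y\<close> as the multiple of \<open>Tx\<close> of the same length as \<open>x\<close> is optimal.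
\<close>

lemma norm_le_of_symmetric_form_le:
  fixes T :: "'a::complex_inner \<Rightarrow> 'a"
  assumes "linear T"
    and sym: "\<And>x y. Re (cinner (T x) y) = Re (cinner x (T y))"
    and form: "\<And>x. \<bar>Re (cinner (T x) x)\<bar> \<le> M * (norm x)\<^sup>2"
  shows "norm (T x) \<le> M * norm x"
proof (cases "T x = 0 \<or> x = 0")
  case True
  moreover have "0 \<le> M * norm x"
  proof (cases "x = 0")
    case False
    have "0 \<le> M * (norm x)\<^sup>2"
      using form[of x] abs_ge_zero order_trans by blast
    with False show ?thesis
      by (simp add: zero_le_mult_iff)
  qed simp
  ultimately show ?thesis
    using linear_0[OF \<open>linear T\<close>] by auto
next
  case False
  define y where "y = (norm x / norm (T x)) *\<^sub>R T x"
  have norm_y: "norm y = norm x"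
    using False by (simp add: y_def)
  have "Re (cinner (T x) y) = norm x * norm (T x)"
    using False by (simp add: y_def cinner_linear power2_eq_square flip: power2_norm_eq_Re_cinner)
  then have "4 * (norm x * norm (T x))
      = Re (cinner (T (x + y)) (x + y)) - Re (cinner (T (x - y)) (x - y))"
    using sym[of y x] Re_cinner_commute[of y "T x"]
    by (simp add: linear_add[OF \<open>linear T\<close>] linear_diff[OF \<open>linear T\<close>] cinner_linear)
  also have "\<dots> \<le> M * (norm (x + y))\<^sup>2 + M * (norm (x - y))\<^sup>2"
    using form[of "x + y"] form[of "x - y"] by linarith
  also have "\<dots> = 4 * (norm x * (M * norm x))"
    using parallelogram_law[of x y]
    by (simp add: norm_y power2_eq_square flip: distrib_left)
  finally show ?thesis
    using False by simp
qed

lemma cmod_cinner_le_numerical_radius: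
  fixes A :: "'a::chilbert_space \<Rightarrow> 'a"
  assumes "bounded_clinear A"
  shows "cmod (cinner (A x) x) \<le> numerical_radius A * (norm x)\<^sup>2"
proof -
  interpret A: bounded_linear A
    using assms by (simp add: bounded_clinear_def)
  have unit: "cmod (cinner (A u) u) \<le> numerical_radius A" if "norm u = 1" for u
    unfolding numerical_radius_def
  proof (rule cSUP_upper)
    obtain K where K: "\<And>x. norm (A x) \<le> norm x * K"
      using A.bounded by auto
    show "bdd_above ((\<lambda>x. cmod (cinner (A x) x)) ` {x. norm x = 1})"
    proof (rule bdd_aboveI2)
      fix x :: 'a
      assume "x \<in> {x. norm x = 1}"
      then show "cmod (cinner (A x) x) \<le> K"
        using cmod_cinner_le_norm[of "A x" x] K[of x] by simp
    qed
  qed (use that in simp)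
  show ?thesis
  proof (cases "x = 0")
    case True
    then show ?thesis
      using cinner_eq_zero_iff[of x] by (simp add: A.zero)
  next
    case False
    define u where "u = (1 / norm x) *\<^sub>R x"
    have x: "x = norm x *\<^sub>R u" and "norm u = 1"
      using False by (simp_all add: u_def)
    have "cinner (A x) x = of_real ((norm x)\<^sup>2) * cinner (A u) u"
      by (subst (1 2) x) (simp add: A.scaleR cinner_linear power2_eq_square)
    then have "cmod (cinner (A x) x) = (norm x)\<^sup>2 * cmod (cinner (A u) u)"
      by (simp add: norm_mult norm_power)
    also have "\<dots> \<le> (norm x)\<^sup>2 * numerical_radius A"
      by (intro mult_left_mono unit \<open>norm u = 1\<close>) simp
    finally show ?thesis
      by (simp add: mult.commute)
  qed
qed

text \<open>
  The absolute value around the numerical radius makes the bound hold on the zero space as well,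
  where the supremum defining the numerical radius could be any real number.
\<close>

lemma onorm_le_sqrt2_numerical_radius:
  fixes A T :: "'a::chilbert_space \<Rightarrow> 'a"
  assumes A: "bounded_clinear A" and T: "linear T"
    and sym: "\<And>x y. cinner (T x) y = cinner x (T y)"
    and form: "\<And>x. \<bar>Re (cinner (T x) x)\<bar> \<le> \<bar>Re (cinner (A x) x)\<bar> + \<bar>Im (cinner (A x) x)\<bar>"
  shows "onorm T \<le> sqrt 2 * \<bar>numerical_radius A\<bar>"
proof (rule onorm_bound)
  show "norm (T x) \<le> sqrt 2 * \<bar>numerical_radius A\<bar> * norm x" for x
  proof (rule norm_le_of_symmetric_form_le[OF T])
    fix x
    have "\<bar>Re (cinner (T x) x)\<bar> \<le> sqrt 2 * cmod (cinner (A x) x)"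
      using form[of x] complex_abs_le_norm[of "cinner (A x) x"] by linarith
    also have "\<dots> \<le> sqrt 2 * (\<bar>numerical_radius A\<bar> * (norm x)\<^sup>2)"
    proof (intro mult_left_mono)
      have "numerical_radius A * (norm x)\<^sup>2 \<le> \<bar>numerical_radius A\<bar> * (norm x)\<^sup>2"
        by (intro mult_right_mono) auto
      then show "cmod (cinner (A x) x) \<le> \<bar>numerical_radius A\<bar> * (norm x)\<^sup>2"
        using cmod_cinner_le_numerical_radius[OF A, of x] by linarith
    qed simp
    finally show "\<bar>Re (cinner (T x) x)\<bar> \<le> sqrt 2 * \<bar>numerical_radius A\<bar> * (norm x)\<^sup>2"
      by (simp add: mult.assoc)
  qed (simp add: sym)
qed simp

theorem theorem2p6:
  fixes A :: "'a::chilbert_space \<Rightarrow> 'a"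
  assumes "bounded_clinear A"
  shows "1 / 4 * onorm (\<lambda>x. cadjoint A (A x) + A (cadjoint A x))
      \<le> 1 / 4 * sqrt (3 / 2 * onorm (\<lambda>x. op_Re A x + op_Im A x) ^ 4
                     + 3 / 2 * onorm (\<lambda>x. op_Re A x - op_Im A x) ^ 4
                     + onorm (\<lambda>x. op_Re A x + op_Im A x) ^ 2
                       * onorm (\<lambda>x. op_Re A x - op_Im A x) ^ 2)
    \<and> 1 / 4 * sqrt (3 / 2 * onorm (\<lambda>x. op_Re A x + op_Im A x) ^ 4
                     + 3 / 2 * onorm (\<lambda>x. op_Re A x - op_Im A x) ^ 4
                     + onorm (\<lambda>x. op_Re A x + op_Im A x) ^ 2
                       * onorm (\<lambda>x. op_Re A x - op_Im A x) ^ 2)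
      \<le> (numerical_radius A) ^ 2"
proof -
  define S where "S = (\<lambda>x. op_Re A x + op_Im A x)"
  define D where "D = (\<lambda>x. op_Re A x - op_Im A x)"
  define s where "s = onorm S"
  define d where "d = onorm D"
  define w where "w = numerical_radius A"
  note bl = bounded_linear_op_Re[OF assms] bounded_linear_op_Im[OF assms]
  have S: "bounded_linear S" and D: "bounded_linear D"
    unfolding S_def D_def using bl by (auto intro: bounded_linear_add bounded_linear_sub)
  have nonneg: "0 \<le> s" "0 \<le> d"
    unfolding s_def d_def by (simp_all add: onorm_pos_le S D)
  note self_adjoint = cinner_op_Re[OF assms] cinner_op_Im[OF assms]
  note form = Re_cinner_op_Re[OF assms] Re_cinner_op_Im[OF assms]

  have "onorm (\<lambda>x. cadjoint A (A x) + A (cadjoint A x)) \<le> s\<^sup>2 + d\<^sup>2"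
  proof (rule onorm_bound)
    fix x
    have "norm (S (S x)) \<le> s * (s * norm x)" "norm (D (D x)) \<le> d * (d * norm x)"
      using onorm[OF S] onorm[OF D] nonneg unfolding s_def d_def
      by (meson mult_left_mono order_trans)+
    then have "norm (S (S x) + D (D x)) \<le> s * (s * norm x) + d * (d * norm x)"
      by (rule norm_triangle_mono)
    then show "norm (cadjoint A (A x) + A (cadjoint A x)) \<le> (s\<^sup>2 + d\<^sup>2) * norm x"
      unfolding cadjoint_sum_eq_squares[OF assms] S_def D_def
      by (simp add: power2_eq_square algebra_simps)
  qed simp
  also have "s\<^sup>2 + d\<^sup>2 \<le> sqrt (3 / 2 * s ^ 4 + 3 / 2 * d ^ 4 + s\<^sup>2 * d\<^sup>2)"
  proof (rule real_le_rsqrt)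
    have "3 / 2 * s ^ 4 + 3 / 2 * d ^ 4 + s\<^sup>2 * d\<^sup>2 - (s\<^sup>2 + d\<^sup>2)\<^sup>2 = (s\<^sup>2 - d\<^sup>2)\<^sup>2 / 2"
      by (simp add: power2_eq_square power4_eq_xxxx field_simps)
    also have "\<dots> \<ge> 0"
      by simp
    finally show "(s\<^sup>2 + d\<^sup>2)\<^sup>2 \<le> 3 / 2 * s ^ 4 + 3 / 2 * d ^ 4 + s\<^sup>2 * d\<^sup>2"
      by simp
  qed
  finally have first: "onorm (\<lambda>x. cadjoint A (A x) + A (cadjoint A x))
      \<le> sqrt (3 / 2 * s ^ 4 + 3 / 2 * d ^ 4 + s\<^sup>2 * d\<^sup>2)" .

  have "s \<le> sqrt 2 * \<bar>w\<bar>"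
    unfolding s_def w_def
  proof (rule onorm_le_sqrt2_numerical_radius[OF assms])
    show "linear S"
      using S by (rule bounded_linear.linear)
  qed (use self_adjoint form in \<open>auto simp: S_def cinner_linear\<close>)
  moreover have "d \<le> sqrt 2 * \<bar>w\<bar>"
    unfolding d_def w_def
  proof (rule onorm_le_sqrt2_numerical_radius[OF assms])
    show "linear D"
      using D by (rule bounded_linear.linear)
  qed (use self_adjoint form in \<open>auto simp: D_def cinner_linear\<close>)
  ultimately have "s\<^sup>2 \<le> (sqrt 2 * \<bar>w\<bar>)\<^sup>2" "d\<^sup>2 \<le> (sqrt 2 * \<bar>w\<bar>)\<^sup>2"
    using nonneg by (auto intro: power_mono)
  then have sd: "s\<^sup>2 \<le> 2 * w\<^sup>2" "d\<^sup>2 \<le> 2 * w\<^sup>2"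
    by (simp_all add: power_mult_distrib)
  have "sqrt (3 / 2 * s ^ 4 + 3 / 2 * d ^ 4 + s\<^sup>2 * d\<^sup>2) \<le> 4 * w\<^sup>2"
  proof (rule real_le_lsqrt)
    have "s ^ 4 \<le> (2 * w\<^sup>2)\<^sup>2" "d ^ 4 \<le> (2 * w\<^sup>2)\<^sup>2" "s\<^sup>2 * d\<^sup>2 \<le> (2 * w\<^sup>2) * (2 * w\<^sup>2)"
      using power_mono[OF sd(1), of 2] power_mono[OF sd(2), of 2] mult_mono[OF sd]
      by (simp_all flip: power_mult)
    then show "3 / 2 * s ^ 4 + 3 / 2 * d ^ 4 + s\<^sup>2 * d\<^sup>2 \<le> (4 * w\<^sup>2)\<^sup>2"
      by (simp add: power_mult_distrib power2_eq_square)
  qed simp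
  with first show ?thesis
    unfolding s_def d_def w_def S_def D_def by simp
qed

end
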